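(* Let $\alpha\geq 2$ be any ordinal and let $X$ be any set. The only zero-dimensional elements in the free algebra $\mathfrak{Fr}_X\mathsf{Drs}_{\alpha}$ are the zero $0$ and the unit $1$.
   Context: For sequences $f,g$ of length $\alpha$ and $i\in\alpha$, write $f\equiv_i g$ iff $f(j)=g(j)$ for all $j\in\alpha\setminus\{i\}$. For a set $V$ of sequences of length $\alpha$, $i\in\alpha$ and $Y\subseteq V$, put $C_i^{[V]}Y=\{f\in V:(\exists g\in Y)\ f\equiv_i g\}$. Let $\mathfrak{P}(V)=\langle \mathcal{P}(V),\cap,\cup,\setminus,\emptyset,V,C_i^{[V]}\rangle_{i\in\alpha}$, where $\setminus$ is complementation relative to $V$; it is an algebra in the signature $\cdot,+,-,0,1,c_i$ $(i\in\alpha)$. $\mathsf{Drs}_\alpha$ is the class of all isomorphic copies of subalgebras of algebras $\mathfrak{P}(V)$ with $\emptyset\neq V\subseteq{}^{\alpha}U$ for some set $U$. The free algebra $\mathfrak{Fr}_X\mathsf{Drs}_\alpha$ is the algebra of all terms in this signature with variables from $X$, modulo the congruence identifying terms $s,t$ iff the equation $s=t$ is valid in $\mathsf{Drs}_\alpha$. An element $a$ of an algebra in this signature is zero-dimensional if $\Delta a=\{i\in\alpha: c_i a\neq a\}$ is empty, i.e. $c_i a=a$ for all $i\in\alpha$. *)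

theory Defs
  imports Main "HOL-Library.Infinite_Typeclass" "HOL-Library.Countable_Set"
begin

text \<open>
  The ordinal \<open>\<alpha>\<close> is represented by an index type \<open>'i\<close>, taken in class \<^class>\<open>wellorder\<close> in the
  final theorem, and sequences of length \<open>\<alpha>\<close> over \<open>U\<close> are functions \<open>'i \<Rightarrow> 'u\<close> with range in \<open>U\<close>.
  The variable set \<open>X\<close> is a set (possibly empty) of elements of a type \<open>'x\<close>.
\<close>

subsection \<open>Algebras in the signature of cylindric algebras\<close>

record ('i, 'a) cyl_alg =
  carr :: "'a set"
  meet :: "'a \<Rightarrow> 'a \<Rightarrow> 'a"
  join :: "'a \<Rightarrow> 'a \<Rightarrow> 'a"
  compl :: "'a \<Rightarrow> 'a"
  zero :: "'a"
  unit :: "'a"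
  cyl :: "'i \<Rightarrow> 'a \<Rightarrow> 'a"

definition subuniverse :: "'a set \<Rightarrow> ('i, 'a) cyl_alg \<Rightarrow> bool" where
  "subuniverse S A \<longleftrightarrow>
     S \<subseteq> carr A \<and> zero A \<in> S \<and> unit A \<in> S \<and>
     (\<forall>a\<in>S. \<forall>b\<in>S. meet A a b \<in> S \<and> join A a b \<in> S) \<and>
     (\<forall>a\<in>S. compl A a \<in> S \<and> (\<forall>i. cyl A i a \<in> S))"

definition algebra :: "('i, 'a) cyl_alg \<Rightarrow> bool" where
  "algebra A \<longleftrightarrow> subuniverse (carr A) A"

definition subalgebra :: "('i, 'a) cyl_alg \<Rightarrow> ('i, 'a) cyl_alg \<Rightarrow> bool" where
  "subalgebra B A \<longleftrightarrow> subuniverse (carr B) A \<and> B = A\<lparr>carr := carr B\<rparr>"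

definition iso :: "('a \<Rightarrow> 'b) \<Rightarrow> ('i, 'a) cyl_alg \<Rightarrow> ('i, 'b) cyl_alg \<Rightarrow> bool" where
  "iso h A B \<longleftrightarrow>
     bij_betw h (carr A) (carr B) \<and> h (zero A) = zero B \<and> h (unit A) = unit B \<and>
     (\<forall>a\<in>carr A. \<forall>b\<in>carr A. h (meet A a b) = meet B (h a) (h b) \<and>
                             h (join A a b) = join B (h a) (h b)) \<and>
     (\<forall>a\<in>carr A. h (compl A a) = compl B (h a) \<and> (\<forall>i. h (cyl A i a) = cyl B i (h a)))"

definition dim_set :: "('i, 'a) cyl_alg \<Rightarrow> 'a \<Rightarrow> 'i set" where
  "dim_set A a = {i. cyl A i a \<noteq> a}"

definition zero_dimensional :: "('i, 'a) cyl_alg \<Rightarrow> 'a \<Rightarrow> bool" where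
  "zero_dimensional A a \<longleftrightarrow> dim_set A a = {}"

subsection \<open>Relativized set algebras\<close>

definition agree_off :: "'i \<Rightarrow> ('i \<Rightarrow> 'u) \<Rightarrow> ('i \<Rightarrow> 'u) \<Rightarrow> bool" where
  "agree_off i f g \<longleftrightarrow> (\<forall>j. j \<noteq> i \<longrightarrow> f j = g j)"

definition cylindrification :: "('i \<Rightarrow> 'u) set \<Rightarrow> 'i \<Rightarrow> ('i \<Rightarrow> 'u) set \<Rightarrow> ('i \<Rightarrow> 'u) set" where
  "cylindrification V i Y = {f \<in> V. \<exists>g\<in>Y. agree_off i f g}"

definition full_set_alg :: "('i \<Rightarrow> 'u) set \<Rightarrow> ('i, ('i \<Rightarrow> 'u) set) cyl_alg" where
  "full_set_alg V =
     \<lparr>carr = Pow V, meet = (\<inter>), join = (\<union>), compl = (\<lambda>Y. V - Y),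
      zero = {}, unit = V, cyl = cylindrification V\<rparr>"

text \<open>
  A class of algebras over arbitrary sets cannot be formed in HOL, so \<open>Drs\<close> has two type
  parameters: the type \<open>'u\<close> from which the base sets \<open>U\<close> are taken and the type \<open>'a\<close> of elements of
  the isomorphic copies.
\<close>

definition Drs :: "'u itself \<Rightarrow> ('i, 'a) cyl_alg set" where
  "Drs TYPE('u) =
     {A. algebra A \<and>
         (\<exists>(U :: 'u set) (V :: ('i \<Rightarrow> 'u) set) B h.
            V \<noteq> {} \<and> V \<subseteq> {f. range f \<subseteq> U} \<and> subalgebra B (full_set_alg V) \<and> iso h A B)}"

subsection \<open>Terms, equations and the free algebra\<close>

datatype ('i, vars: 'x) trm =
    Var 'x
  | Meet "('i, 'x) trm" "('i, 'x) trm"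
  | Join "('i, 'x) trm" "('i, 'x) trm"
  | Compl "('i, 'x) trm"
  | Zero
  | Unit
  | Cyl 'i "('i, 'x) trm"

primrec eval :: "('i, 'a) cyl_alg \<Rightarrow> ('x \<Rightarrow> 'a) \<Rightarrow> ('i, 'x) trm \<Rightarrow> 'a" where
  "eval A e (Var x) = e x"
| "eval A e (Meet s t) = meet A (eval A e s) (eval A e t)"
| "eval A e (Join s t) = join A (eval A e s) (eval A e t)"
| "eval A e (Compl t) = compl A (eval A e t)"
| "eval A e Zero = zero A"
| "eval A e Unit = unit A"
| "eval A e (Cyl i t) = cyl A i (eval A e t)"

definition satisfies :: "('i, 'a) cyl_alg \<Rightarrow> ('i, 'x) trm \<Rightarrow> ('i, 'x) trm \<Rightarrow> bool" where
  "satisfies A s t \<longleftrightarrow> (\<forall>e. range e \<subseteq> carr A \<longrightarrow> eval A e s = eval A e t)"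

text \<open>
  Validity in \<open>Drs\<close>. The base type \<open>'u\<close> plays the role of a universe and has to be infinite, since
  a finite type would bound the size of the bases. The carrier type is taken large enough to contain
  all subalgebras of full set algebras themselves. The lemma \<open>Drs_valid_universal\<close> below shows
  that an equation valid in this sense is satisfied by all members of \<open>Drs\<close> for any other choice
  of base type and carrier type, so the choice of \<open>'u\<close> is immaterial.
\<close>

definition Drs_valid :: "'u::infinite itself \<Rightarrow> ('i, 'x) trm \<Rightarrow> ('i, 'x) trm \<Rightarrow> bool" where
  "Drs_valid TYPE('u) s t \<longleftrightarrow>
     (\<forall>A \<in> (Drs TYPE('u) :: ('i, ('i \<Rightarrow> 'u) set) cyl_alg set). satisfies A s t)"

definition terms_over :: "'x set \<Rightarrow> ('i, 'x) trm set" where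
  "terms_over X = {t. vars t \<subseteq> X}"

definition Drs_cong :: "'u::infinite itself \<Rightarrow> 'x set \<Rightarrow> (('i, 'x) trm \<times> ('i, 'x) trm) set" where
  "Drs_cong TYPE('u) X =
     {(s, t). s \<in> terms_over X \<and> t \<in> terms_over X \<and> Drs_valid TYPE('u) s t}"

definition Fr_Drs :: "'u::infinite itself \<Rightarrow> 'x set \<Rightarrow> ('i, ('i, 'x) trm set) cyl_alg" where
  "Fr_Drs TYPE('u) X =
     (let R = Drs_cong TYPE('u) X in
      \<lparr>carr = terms_over X // R,
       meet = (\<lambda>P Q. \<Union>s\<in>P. \<Union>t\<in>Q. R `` {Meet s t}),
       join = (\<lambda>P Q. \<Union>s\<in>P. \<Union>t\<in>Q. R `` {Join s t}),
       compl = (\<lambda>P. \<Union>t\<in>P. R `` {Compl t}),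
       zero = R `` {Zero},
       unit = R `` {Unit},
       cyl = (\<lambda>i P. \<Union>t\<in>P. R `` {Cyl i t})\<rparr>)"

subsection \<open>Basic properties of the congruence and of the free algebra\<close>

lemma equiv_Drs_cong: "equiv (terms_over X) (Drs_cong TYPE('u::infinite) X)"
  by (rule equivI)
    (auto simp: Drs_cong_def Drs_valid_def satisfies_def refl_on_def sym_def trans_def)

lemma Drs_cong_ops:
  fixes X :: "'x set"
  defines "R \<equiv> Drs_cong TYPE('u::infinite) X :: (('i, 'x) trm \<times> ('i, 'x) trm) set"
  shows "(s, s') \<in> R \<Longrightarrow> (t, t') \<in> R \<Longrightarrow> (Meet s t, Meet s' t') \<in> R"
    and "(s, s') \<in> R \<Longrightarrow> (t, t') \<in> R \<Longrightarrow> (Join s t, Join s' t') \<in> R"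
    and "(t, t') \<in> R \<Longrightarrow> (Compl t, Compl t') \<in> R"
    and "(t, t') \<in> R \<Longrightarrow> (Cyl i t, Cyl i t') \<in> R"
  by (auto simp: R_def Drs_cong_def Drs_valid_def satisfies_def terms_over_def)

lemma Fr_Drs_ops:
  fixes X :: "'x set" and s t :: "('i, 'x) trm"
  defines "R \<equiv> Drs_cong TYPE('u::infinite) X :: (('i, 'x) trm \<times> ('i, 'x) trm) set"
  assumes "s \<in> terms_over X" "t \<in> terms_over X"
  shows "meet (Fr_Drs TYPE('u) X) (R `` {s}) (R `` {t}) = R `` {Meet s t}"
    and "join (Fr_Drs TYPE('u) X) (R `` {s}) (R `` {t}) = R `` {Join s t}"
    and "compl (Fr_Drs TYPE('u) X) (R `` {t}) = R `` {Compl t}"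
    and "cyl (Fr_Drs TYPE('u) X) i (R `` {t}) = R `` {Cyl i t}"
proof -
  have eq: "equiv (terms_over X) R"
    unfolding R_def by (rule equiv_Drs_cong)
  have self: "(s, s) \<in> R" "(t, t) \<in> R"
    using eq assms(2,3) by (auto simp: equiv_def refl_on_def)
  note cong = Drs_cong_ops[where 'u='u and 'i='i and X=X, folded R_def]
  show "meet (Fr_Drs TYPE('u) X) (R `` {s}) (R `` {t}) = R `` {Meet s t}"
    using equiv_class_eq[OF eq cong(1)] self
    by (fastforce simp: Fr_Drs_def Let_def R_def[symmetric])
  show "join (Fr_Drs TYPE('u) X) (R `` {s}) (R `` {t}) = R `` {Join s t}"
    using equiv_class_eq[OF eq cong(2)] self
    by (fastforce simp: Fr_Drs_def Let_def R_def[symmetric])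
  show "compl (Fr_Drs TYPE('u) X) (R `` {t}) = R `` {Compl t}"
    using equiv_class_eq[OF eq cong(3)] self
    by (fastforce simp: Fr_Drs_def Let_def R_def[symmetric])
  show "cyl (Fr_Drs TYPE('u) X) i (R `` {t}) = R `` {Cyl i t}"
    using equiv_class_eq[OF eq cong(4)] self
    by (fastforce simp: Fr_Drs_def Let_def R_def[symmetric])
qed

lemma algebra_Fr_Drs:
  "algebra (Fr_Drs TYPE('u::infinite) X :: ('i, ('i, 'x) trm set) cyl_alg)"
proof -
  let ?F = "Fr_Drs TYPE('u) X :: ('i, ('i, 'x) trm set) cyl_alg"
  let ?R = "Drs_cong TYPE('u) X :: (('i, 'x) trm \<times> ('i, 'x) trm) set"
  have carr: "carr ?F = terms_over X // ?R" "zero ?F = ?R `` {Zero}" "unit ?F = ?R `` {Unit}"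
    by (simp_all add: Fr_Drs_def Let_def)
  have ops: "Zero \<in> terms_over X" "Unit \<in> terms_over X"
    "\<And>s t :: ('i, 'x) trm. s \<in> terms_over X \<Longrightarrow> t \<in> terms_over X \<Longrightarrow>
       Meet s t \<in> terms_over X \<and> Join s t \<in> terms_over X"
    "\<And>t :: ('i, 'x) trm. t \<in> terms_over X \<Longrightarrow> Compl t \<in> terms_over X"
    "\<And>i (t :: ('i, 'x) trm). t \<in> terms_over X \<Longrightarrow> Cyl i t \<in> terms_over X"
    by (auto simp: terms_over_def)
  show ?thesis
    unfolding algebra_def subuniverse_def carr
    by (auto elim!: quotientE simp: Fr_Drs_ops ops intro!: quotientI)
qed

subsection \<open>Independence of the universe\<close>

lemma iso_eval:
  assumes "algebra A" "iso h A B" "range e \<subseteq> carr A"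
  shows "eval A e t \<in> carr A \<and> h (eval A e t) = eval B (h \<circ> e) t"
  using assms by (induction t) (auto simp: algebra_def subuniverse_def iso_def image_subset_iff)

lemma eval_full_set_alg_carr: "eval (full_set_alg V\<lparr>carr := S\<rparr>) e t = eval (full_set_alg V) e t"
  by (induction t) (auto simp: full_set_alg_def)

lemma eval_full_set_alg_subset:
  "(\<And>x. e x \<subseteq> V) \<Longrightarrow> eval (full_set_alg V) e t \<subseteq> V"
  by (induction t) (auto simp: full_set_alg_def cylindrification_def)

lemma full_set_alg_in_Drs:
  fixes V :: "('i \<Rightarrow> 'u) set"
  assumes "V \<noteq> {}"
  shows "full_set_alg V \<in> Drs TYPE('u)"
proof -
  have alg: "subuniverse (Pow V) (full_set_alg V)"
    by (auto simp: subuniverse_def full_set_alg_def cylindrification_def)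
  have c: "carr (full_set_alg V) = Pow V"
    by (simp add: full_set_alg_def)
  have "subalgebra (full_set_alg V) (full_set_alg V)" "iso id (full_set_alg V) (full_set_alg V)"
    using alg by (auto simp: subalgebra_def iso_def c)
  moreover have "V \<subseteq> {f. range f \<subseteq> (UNIV :: 'u set)}" by simp
  ultimately show ?thesis
    unfolding Drs_def algebra_def using alg assms c by auto blast
qed

lemma countable_witness_closure:
  fixes w :: "'f \<Rightarrow> 'c \<Rightarrow> 'f"
  assumes "countable C"
  obtains W where "countable W" "f \<in> W" "\<And>g c. g \<in> W \<Longrightarrow> c \<in> C \<Longrightarrow> w g c \<in> W"
proof
  let ?W = "foldl w f ` lists C"
  show "countable ?W" using assms by simp
  show "f \<in> ?W" by (rule image_eqI[of _ _ "[]"]) auto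
  show "w g c \<in> ?W" if g: "g \<in> ?W" and c: "c \<in> C" for g c
  proof -
    obtain cs where "cs \<in> lists C" "g = foldl w f cs" using g by blast
    then show ?thesis using c by (intro image_eqI[of _ _ "cs @ [c]"]) auto
  qed
qed

primrec subterms :: "('i, 'x) trm \<Rightarrow> ('i, 'x) trm set" where
  "subterms (Var x) = {Var x}"
| "subterms (Meet s t) = insert (Meet s t) (subterms s \<union> subterms t)"
| "subterms (Join s t) = insert (Join s t) (subterms s \<union> subterms t)"
| "subterms (Compl t) = insert (Compl t) (subterms t)"
| "subterms Zero = {Zero}"
| "subterms Unit = {Unit}"
| "subterms (Cyl i t) = insert (Cyl i t) (subterms t)"

lemma finite_subterms: "finite (subterms t)"
  by (induction t) auto

lemma subterms_self: "t \<in> subterms t"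
  by (cases t) auto

lemma countable_inj_into_infinite:
  assumes "countable (A :: 'a set)"
  obtains c :: "'a \<Rightarrow> 'u::infinite" where "inj_on c A"
proof -
  obtain p :: "nat \<Rightarrow> 'u" where "inj p"
    using infinite_countable_subset[OF infinite_UNIV] by blast
  then have "inj_on (p \<circ> to_nat_on A) A"
    using assms by (intro comp_inj_on) (auto intro: inj_on_subset)
  then show ?thesis using that by blast
qed

text \<open>
  Any evaluation in a full set algebra can be transferred, for finitely many terms, to a full set
  algebra over any given infinite type: pass to a countable set of sequences containing all needed
  witnesses, and rename the values in every coordinate separately.
\<close>

lemma transfer_eval:
  fixes V :: "('i \<Rightarrow> 'v) set" and s t :: "('i, 'x) trm"
  assumes e: "\<And>x. e x \<subseteq> V" and f: "f \<in> V"
  obtains V' :: "('i \<Rightarrow> 'u::infinite) set" and e' f' where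
    "\<And>x. e' x \<subseteq> V'" "f' \<in> V'"
    "f' \<in> eval (full_set_alg V') e' s \<longleftrightarrow> f \<in> eval (full_set_alg V) e s"
    "f' \<in> eval (full_set_alg V') e' t \<longleftrightarrow> f \<in> eval (full_set_alg V) e t"
proof -
  let ?E = "eval (full_set_alg V) e"
  define T where "T = subterms s \<union> subterms t"
  define P where "P g c h \<longleftrightarrow> h \<in> V \<and> (\<exists>i r. c = Cyl i r \<and> h \<in> ?E r \<and> agree_off i g h)" for g c h
  define w where "w g c = (if \<exists>h. P g c h then SOME h. P g c h else g)" for g c
  have P_w: "P g c (w g c)" if "P g c h" for g c h
    using that someI[of "P g c" h] by (auto simp: w_def)
  have "countable T" by (simp add: T_def finite_subterms countable_finite)
  then obtain W0 where W0: "countable W0" "f \<in> W0" "\<And>g c. g \<in> W0 \<Longrightarrow> c \<in> T \<Longrightarrow> w g c \<in> W0"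
    by (rule countable_witness_closure[of T f w]) blast
  define W where "W = W0 \<inter> V"
  have W: "countable W" "f \<in> W" "W \<subseteq> V"
    using W0 f by (auto simp: W_def)
  have wit: "\<exists>h\<in>W. h \<in> ?E r \<and> agree_off i g h" 
    if "g \<in> W" "Cyl i r \<in> T" "h \<in> ?E r" "agree_off i g h" for g i r h
  proof -
    have "h \<in> V" using eval_full_set_alg_subset[of e V r, OF e] that(3) by blast
    then have "P g (Cyl i r) (w g (Cyl i r))" using that by (intro P_w[of _ _ h]) (auto simp: P_def)
    then show ?thesis using W0(3)[of g "Cyl i r"] that by (auto simp: P_def W_def)
  qed
  have "\<exists>c :: 'v \<Rightarrow> 'u. inj_on c ((\<lambda>g. g i) ` W)" for i
    using countable_inj_into_infinite[of "(\<lambda>g. g i) ` W"] W(1) by blast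
  then obtain c :: "'i \<Rightarrow> 'v \<Rightarrow> 'u" where c: "\<And>i. inj_on (c i) ((\<lambda>g. g i) ` W)" by metis
  define \<Phi> where "\<Phi> g = (\<lambda>i. c i (g i))" for g
  have coord: "\<Phi> g j = \<Phi> h j \<longleftrightarrow> g j = h j" if "g \<in> W" "h \<in> W" for g h j
    using inj_on_eq_iff[OF c[of j], of "g j" "h j"] that by (auto simp: \<Phi>_def)
  have inj: "\<Phi> g = \<Phi> h \<longleftrightarrow> g = h" if "g \<in> W" "h \<in> W" for g h
    using coord[OF that] by (auto simp: fun_eq_iff)
  have agree: "agree_off i (\<Phi> g) (\<Phi> h) \<longleftrightarrow> agree_off i g h" if "g \<in> W" "h \<in> W" for g h i
    using coord[OF that] by (auto simp: agree_off_def)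
  define V' where "V' = \<Phi> ` W"
  define e' where "e' x = \<Phi> ` (e x \<inter> W)" for x
  let ?E' = "eval (full_set_alg V') e'"
  have sub: "?E' r \<subseteq> V'" for r
    by (rule eval_full_set_alg_subset) (auto simp: e'_def V'_def)
  have main: "subterms r \<subseteq> T \<Longrightarrow> \<forall>g\<in>W. \<Phi> g \<in> ?E' r \<longleftrightarrow> g \<in> ?E r" for r
  proof (induction r)
    case (Var x)
    then show ?case using inj by (auto simp: e'_def)
  next
    case (Cyl i r)
    then have IH: "\<And>g. g \<in> W \<Longrightarrow> \<Phi> g \<in> ?E' r \<longleftrightarrow> g \<in> ?E r" and T: "Cyl i r \<in> T" by auto
    show ?case
    proof
      fix g assume g: "g \<in> W"
      have "\<Phi> g \<in> ?E' (Cyl i r) \<longleftrightarrow> (\<exists>h\<in>?E' r. agree_off i (\<Phi> g) h)"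
        using g by (auto simp: full_set_alg_def cylindrification_def V'_def)
      also have "\<dots> \<longleftrightarrow> (\<exists>h\<in>W. \<Phi> h \<in> ?E' r \<and> agree_off i (\<Phi> g) (\<Phi> h))"
        using sub[of r] unfolding V'_def by blast
      also have "\<dots> \<longleftrightarrow> (\<exists>h\<in>W. h \<in> ?E r \<and> agree_off i g h)"
        using IH agree[OF g] by blast
      also have "\<dots> \<longleftrightarrow> (\<exists>h\<in>?E r. agree_off i g h)"
        using wit[OF g T] by blast
      also have "\<dots> \<longleftrightarrow> g \<in> ?E (Cyl i r)"
        using g W(3) by (auto simp: full_set_alg_def cylindrification_def)
      finally show "\<Phi> g \<in> ?E' (Cyl i r) \<longleftrightarrow> g \<in> ?E (Cyl i r)" .
    qed
  qed (use W(3) in \<open>auto simp: full_set_alg_def V'_def\<close>)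
  show ?thesis
  proof (rule that)
    show "e' x \<subseteq> V'" for x by (auto simp: e'_def V'_def)
    show "\<Phi> f \<in> V'" using W(2) by (simp add: V'_def)
    show "\<Phi> f \<in> ?E' s \<longleftrightarrow> f \<in> ?E s" "\<Phi> f \<in> ?E' t \<longleftrightarrow> f \<in> ?E t"
      using main[of s] main[of t] W(2) by (auto simp: T_def)
  qed
qed

theorem Drs_valid_universal:
  fixes A :: "('i, 'a) cyl_alg" and s t :: "('i, 'x) trm"
  assumes valid: "Drs_valid TYPE('u::infinite) s t" and A: "A \<in> Drs TYPE('v)"
  shows "satisfies A s t"
  unfolding satisfies_def
proof (intro allI impI)
  fix e :: "'x \<Rightarrow> 'a" assume e: "range e \<subseteq> carr A"
  obtain V :: "('i \<Rightarrow> 'v) set" and B h where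
    alg: "algebra A" and B: "subalgebra B (full_set_alg V)" and h: "iso h A B"
    using A by (auto simp: Drs_def)
  have he: "h (eval A e r) = eval (full_set_alg V) (h \<circ> e) r" for r
  proof -
    have "B = full_set_alg V\<lparr>carr := carr B\<rparr>" using B by (simp add: subalgebra_def)
    then have "eval B (h \<circ> e) r = eval (full_set_alg V) (h \<circ> e) r"
      using eval_full_set_alg_carr by metis
    then show ?thesis using iso_eval[OF alg h e] by simp
  qed
  have "carr B \<subseteq> Pow V"
    using B by (auto simp: subalgebra_def subuniverse_def full_set_alg_def)
  then have sub: "(h \<circ> e) x \<subseteq> V" for x
    using h e by (auto simp: iso_def bij_betw_def)
  have "f \<in> eval (full_set_alg V) (h \<circ> e) s \<longleftrightarrow> f \<in> eval (full_set_alg V) (h \<circ> e) t"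
    if f: "f \<in> V" for f
  proof -
    obtain V' :: "('i \<Rightarrow> 'u) set" and e' f' where
      V': "\<And>x. e' x \<subseteq> V'" "f' \<in> V'"
        "f' \<in> eval (full_set_alg V') e' s \<longleftrightarrow> f \<in> eval (full_set_alg V) (h \<circ> e) s"
        "f' \<in> eval (full_set_alg V') e' t \<longleftrightarrow> f \<in> eval (full_set_alg V) (h \<circ> e) t"
      by (rule transfer_eval[where e="h \<circ> e", OF sub f, of s t]) blast
    have "full_set_alg V' \<in> Drs TYPE('u)" using V'(2) by (intro full_set_alg_in_Drs) auto
    then have "satisfies (full_set_alg V') s t" using valid by (simp add: Drs_valid_def)
    moreover have "range e' \<subseteq> carr (full_set_alg V')" using V'(1) by (auto simp: full_set_alg_def)
    ultimately show ?thesis using V'(3,4) by (auto simp: satisfies_def)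
  qed
  then have "eval (full_set_alg V) (h \<circ> e) s = eval (full_set_alg V) (h \<circ> e) t"
    using eval_full_set_alg_subset[of "h \<circ> e" V, OF sub] by blast
  then have "h (eval A e s) = h (eval A e t)" by (simp only: he)
  then show "eval A e s = eval A e t"
    using iso_eval[OF alg h e] h by (meson iso_def bij_betw_def inj_onD)
qed

end

theory Submission
  imports Defs "HOL-Library.Sublist"
begin

text \<open>
  Suppose a term \<open>t\<close> is neither \<open>0\<close> nor \<open>1\<close> in the free algebra, so that \<open>t\<close> holds at some point
  \<open>f\<close> of a model and fails at some point \<open>g\<close> of another one. Unravel both models into trees whose
  nodes are paths of single-coordinate moves. Since there are two distinct coordinates, one can
  alternate between them without moving at all, so the unravellings contain copies of \<open>f\<close> and
  \<open>g\<close> at arbitrarily large depth. Join the two trees at a common root, which is invisible to \<open>t\<close> from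
  nodes deeper than the nesting of cylindrifications in \<open>t\<close>. The joined tree is again a set of
  sequences, and in it a deep copy of \<open>f\<close>, where \<open>t\<close> holds, is connected through the root to a
  deep copy of \<open>g\<close>, where \<open>t\<close> fails. Hence \<open>t\<close> is not closed under all cylindrifications.
\<close>

subsection \<open>Validity in full set algebras\<close>

lemma full_set_alg_simps [simp]:
  "carr (full_set_alg V) = Pow V"
  "meet (full_set_alg V) = (\<inter>)"
  "join (full_set_alg V) = (\<union>)"
  "compl (full_set_alg V) Y = V - Y"
  "zero (full_set_alg V) = {}"
  "unit (full_set_alg V) = V"
  "cyl (full_set_alg V) = cylindrification V"
  by (simp_all add: full_set_alg_def)

text \<open>Every algebra in \<open>Drs\<close> embeds in some \<open>full_set_alg V\<close>, and
  evaluation commutes with the embedding. For empty \<open>V\<close> both sides evaluate to the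
  empty set.\<close>

lemma Drs_valid_iff:
  fixes s t :: "('i, 'x) trm"
  shows "Drs_valid TYPE('u::infinite) s t \<longleftrightarrow>
     (\<forall>(V :: ('i \<Rightarrow> 'u) set) e. (\<forall>x. e x \<subseteq> V) \<longrightarrow>
        eval (full_set_alg V) e s = eval (full_set_alg V) e t)"
    (is "?L \<longleftrightarrow> ?R")
proof
  assume valid: ?L
  show ?R
  proof (intro allI impI)
    fix V and e :: "'x \<Rightarrow> ('i \<Rightarrow> 'u) set"
    assume e: "\<forall>x. e x \<subseteq> V"
    show "eval (full_set_alg V) e s = eval (full_set_alg V) e t"
    proof (cases "V = {}")
      case True
      then show ?thesis
        using e eval_full_set_alg_subset[of e V] by fastforce
    next
      case False
      then have "satisfies (full_set_alg V) s t"
        using valid full_set_alg_in_Drs by (auto simp: Drs_valid_def)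
      then show ?thesis
        using e by (auto simp: satisfies_def)
    qed
  qed
next
  assume R: ?R
  show ?L
    unfolding Drs_valid_def satisfies_def
  proof (intro ballI allI impI)
    fix A :: "('i, ('i \<Rightarrow> 'u) set) cyl_alg" and e :: "'x \<Rightarrow> _"
    assume A: "A \<in> Drs TYPE('u)" and e: "range e \<subseteq> carr A"
    obtain V :: "('i \<Rightarrow> 'u) set" and B h where
      alg: "algebra A" and B: "subalgebra B (full_set_alg V)" and h: "iso h A B"
      using A by (auto simp: Drs_def)
    have he: "h (eval A e r) = eval (full_set_alg V) (h \<circ> e) r" for r
    proof -
      have "B = full_set_alg V\<lparr>carr := carr B\<rparr>"
        using B by (simp add: subalgebra_def)
      then have "eval B (h \<circ> e) r = eval (full_set_alg V) (h \<circ> e) r"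
        using eval_full_set_alg_carr by metis
      then show ?thesis
        using iso_eval[OF alg h e] by simp
    qed
    have "carr B \<subseteq> Pow V"
      using B by (auto simp: subalgebra_def subuniverse_def)
    then have "(h \<circ> e) x \<subseteq> V" for x
      using h e by (auto simp: iso_def bij_betw_def)
    then have "eval (full_set_alg V) (h \<circ> e) s = eval (full_set_alg V) (h \<circ> e) t"
      using R by blast
    then have "h (eval A e s) = h (eval A e t)"
      by (simp only: he)
    then show "eval A e s = eval A e t"
      using iso_eval[OF alg h e] h by (meson iso_def bij_betw_def inj_onD)
  qed
qed

subsection \<open>Lists as sequences\<close>

text \<open>
  Paths are lists of moves with the most recent move first. The sequence coding a path records at
  \<open>j\<close> the part of the path up to its last move in direction \<open>j\<close>.
\<close>

definition seq_of :: "('i \<times> 'b) list \<Rightarrow> 'i \<Rightarrow> ('i \<times> 'b) list" where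
  "seq_of w j = dropWhile (\<lambda>m. fst m \<noteq> j) w"

definition strip :: "'i \<Rightarrow> ('i \<times> 'b) list \<Rightarrow> ('i \<times> 'b) list" where
  "strip i w = dropWhile (\<lambda>m. fst m = i) w"

lemma seq_of_strip: "j \<noteq> i \<Longrightarrow> seq_of (strip i w) j = seq_of w j"
  by (induction w) (auto simp: seq_of_def strip_def)

text \<open>In the direction of its latest move, \<open>seq_of w\<close> is all of \<open>w\<close>,
  and each value of \<open>seq_of w'\<close> is a suffix of \<open>w'\<close>.\<close>

lemma suffix_if_seq_of_hd:
  assumes "w \<noteq> [] \<Longrightarrow> seq_of w (fst (hd w)) = seq_of w' (fst (hd w))"
  shows "suffix w w'"
proof (cases w)
  case (Cons m u)
  then have "w = seq_of w' (fst m)"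
    using assms by (simp add: seq_of_def)
  then show ?thesis
    by (metis seq_of_def suffix_dropWhile)
qed simp

text \<open>Coordinates other than \<open>i\<close> ignore leading \<open>i\<close>-moves, so both
  lists may be stripped; a nonempty stripped list begins in another direction, where agreement makes
  it a suffix of the other.\<close>

lemma agree_off_seq_of:
  "agree_off i (seq_of w) (seq_of w') \<longleftrightarrow> strip i w = strip i w'"
proof
  assume agree: "agree_off i (seq_of w) (seq_of w')"
  have hd: "fst (hd (strip i u)) \<noteq> i" if "strip i u \<noteq> []" for u :: "('a \<times> 'b) list"
    using that hd_dropWhile[of "\<lambda>m. fst m = i" u] by (simp add: strip_def)
  have "suffix (strip i w) (strip i w')" "suffix (strip i w') (strip i w)"
    using agree hd by (auto intro!: suffix_if_seq_of_hd simp: seq_of_strip agree_off_def)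
  then show "strip i w = strip i w'"
    by (rule suffix_order.antisym)
next
  assume "strip i w = strip i w'"
  then show "agree_off i (seq_of w) (seq_of w')"
    unfolding agree_off_def by (metis seq_of_strip)
qed

lemma inj_seq_of: "inj seq_of"
proof (rule injI)
  fix w w' :: "('a \<times> 'b) list"
  assume "seq_of w = seq_of w'"
  then have "suffix w w'" "suffix w' w"
    by (auto intro!: suffix_if_seq_of_hd)
  then show "w = w'"
    by (rule suffix_order.antisym)
qed

subsection \<open>Trees of paths\<close>

text \<open>
  The first move of a path, which is the last entry of the list, selects through its index the
  model in which the path lives; its target is unconstrained.
\<close>

abbreviation root :: "('i \<times> 'b) list \<Rightarrow> 'i" where
  "root w \<equiv> fst (last w)"

fun path :: "('i \<Rightarrow> ('i \<Rightarrow> 'u) set) \<Rightarrow> ('i \<times> ('i \<Rightarrow> 'u)) list \<Rightarrow> bool" where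
  "path V [] \<longleftrightarrow> True"
| "path V [(k, g)] \<longleftrightarrow> g \<in> V k"
| "path V ((k, g) # (l, h) # w) \<longleftrightarrow>
     k \<noteq> l \<and> g \<in> V (root ((l, h) # w)) \<and> agree_off k h g \<and> path V ((l, h) # w)"

definition tree :: "('i \<Rightarrow> ('i \<Rightarrow> 'u) set) \<Rightarrow> ('i \<Rightarrow> ('i \<times> ('i \<Rightarrow> 'u)) list) set" where
  "tree V = seq_of ` {w. path V w}"

text \<open>A path stands for the point its latest move reached; the empty path stands for no point,
  so it satisfies no variable.\<close>

definition tree_val ::
  "('i \<Rightarrow> ('i \<Rightarrow> 'u) set) \<Rightarrow> ('i \<Rightarrow> 'x \<Rightarrow> ('i \<Rightarrow> 'u) set) \<Rightarrow> 'x \<Rightarrow> ('i \<Rightarrow> ('i \<times> ('i \<Rightarrow> 'u)) list) set"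
  where "tree_val V e x = seq_of ` {w. path V w \<and> w \<noteq> [] \<and> snd (hd w) \<in> e (root w) x}"

text \<open>Only cylindrifications count: each looks at most one step closer to the root.\<close>

primrec depth :: "('i, 'x) trm \<Rightarrow> nat" where
  "depth (Var x) = 0"
| "depth (Meet s t) = max (depth s) (depth t)"
| "depth (Join s t) = max (depth s) (depth t)"
| "depth (Compl t) = depth t"
| "depth Zero = 0"
| "depth Unit = 0"
| "depth (Cyl i t) = Suc (depth t)"

lemma tree_val_subset: "tree_val V e x \<subseteq> tree V"
  by (auto simp: tree_val_def tree_def)

lemma agree_off_refl: "agree_off i f f"
  by (simp add: agree_off_def)

lemma path_Cons:
  assumes "w \<noteq> []"
  shows "path V ((k, g) # w) \<longleftrightarrow>
    k \<noteq> fst (hd w) \<and> g \<in> V (root w) \<and> agree_off k (snd (hd w)) g \<and> path V w"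
  using assms by (cases w) auto

lemma path_tl: "path V (m # w) \<Longrightarrow> path V w"
  by (cases w; cases m) auto

lemma path_hd_in: "path V w \<Longrightarrow> w \<noteq> [] \<Longrightarrow> snd (hd w) \<in> V (root w)"
  by (induction V w rule: path.induct) auto

text \<open>Consecutive moves of a path differ in direction, so at most one is removed.\<close>

lemma path_strip:
  assumes "path V w"
  shows "strip k w = (if w \<noteq> [] \<and> fst (hd w) = k then tl w else w)"
proof (cases w)
  case (Cons m u)
  show ?thesis
  proof (cases u)
    case Nil
    then show ?thesis
      using Cons by (simp add: strip_def)
  next
    case (Cons m' u')
    then show ?thesis
      using \<open>w = m # u\<close> assms by (cases m; cases m') (auto simp: strip_def)
  qed
qed (simp add: strip_def)

text \<open>If anything remains, the first move survives, and a removed move altered the point only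
  at \<open>k\<close>.\<close>

lemma path_strip_props:
  assumes "path V w" "strip k w \<noteq> []"
  shows "path V (strip k w)" "root (strip k w) = root w"
    "agree_off k (snd (hd (strip k w))) (snd (hd w))" "fst (hd (strip k w)) \<noteq> k"
    "length (strip k w) \<le> length w"
proof -
  have "path V (strip k w) \<and> root (strip k w) = root w \<and>
    agree_off k (snd (hd (strip k w))) (snd (hd w)) \<and> fst (hd (strip k w)) \<noteq> k \<and>
    length (strip k w) \<le> length w"
  proof (cases "w \<noteq> [] \<and> fst (hd w) = k")
    case True
    then obtain g u where w: "w = (k, g) # u"
      by (cases w) auto
    have "strip k w = u"
      using path_strip[OF assms(1)] True w by simp
    moreover from this and assms(2) have "u \<noteq> []"
      by simp
    ultimately show ?thesis
      using assms(1) by (auto simp: w path_Cons)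
  next
    case False
    then have "strip k w = w"
      using path_strip[OF assms(1)] by auto
    then show ?thesis
      using assms False by (simp add: agree_off_refl)
  qed
  then show "path V (strip k w)" "root (strip k w) = root w"
    "agree_off k (snd (hd (strip k w))) (snd (hd w))" "fst (hd (strip k w)) \<noteq> k"
    "length (strip k w) \<le> length w"
    by blast+
qed

lemma path_strip_length: "path V w \<Longrightarrow> length w \<le> Suc (length (strip k w))"
  by (simp add: path_strip)

text \<open>From nodes deeper than the term, the common root of the tree is invisible.\<close>

lemma eval_tree:
  assumes "path V w" "depth t < length w" and e: "\<And>i x. e i x \<subseteq> V i"
  shows "seq_of w \<in> eval (full_set_alg (tree V)) (tree_val V e) t \<longleftrightarrow>
         snd (hd w) \<in> eval (full_set_alg (V (root w))) (e (root w)) t"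
  using assms(1,2)
proof (induction t arbitrary: w)
  case (Var x)
  then show ?case
    by (auto simp: tree_val_def inj_eq[OF inj_seq_of])
next
  case (Cyl k t)
  let ?T = "eval (full_set_alg (tree V)) (tree_val V e) t"
  let ?E = "\<lambda>r. eval (full_set_alg (V r)) (e r) t"
  define u where "u = strip k w"
  have len: "length w \<le> Suc (length u)"
    using path_strip_length[OF Cyl.prems(1)] by (simp add: u_def)
  \<comment> \<open>\<open>Cyl k t\<close> has positive depth, so \<open>w\<close> has two moves or
    more and stripping leaves at least one.\<close>
  then have u_ne: "u \<noteq> []" and w_ne: "w \<noteq> []"
    using Cyl.prems(2) by auto
  note u = path_strip_props[OF Cyl.prems(1), of k, folded u_def, OF u_ne]
  have T_sub: "?T \<subseteq> tree V"
    by (rule eval_full_set_alg_subset) (rule tree_val_subset)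
  have E_sub: "?E r \<subseteq> V r" for r
    by (rule eval_full_set_alg_subset) (rule e)
  have "seq_of w \<in> tree V"
    using Cyl.prems(1) by (auto simp: tree_def)
  then have "seq_of w \<in> eval (full_set_alg (tree V)) (tree_val V e) (Cyl k t) \<longleftrightarrow>
      (\<exists>f\<in>?T. agree_off k (seq_of w) f)"
    by (simp add: cylindrification_def)
  also have "\<dots> \<longleftrightarrow> (\<exists>w'. path V w' \<and> seq_of w' \<in> ?T \<and> strip k w' = u)"
    using T_sub agree_off_seq_of[of k w] by (fastforce simp: tree_def u_def)
  also have "\<dots> \<longleftrightarrow> (\<exists>g\<in>?E (root w). agree_off k (snd (hd w)) g)"
  proof
    assume "\<exists>w'. path V w' \<and> seq_of w' \<in> ?T \<and> strip k w' = u"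
    then obtain w' where w': "path V w'" "seq_of w' \<in> ?T" "strip k w' = u"
      by blast
    note u' = path_strip_props[OF w'(1), of k, unfolded w'(3), OF u_ne]
    have "depth t < length w'"
      using u'(5) len Cyl.prems(2) by simp
    then have "snd (hd w') \<in> ?E (root w)"
      using Cyl.IH[OF w'(1)] w'(2) u(2) u'(2) by simp
    moreover have "agree_off k (snd (hd w)) (snd (hd w'))"
      using u(3) u'(3) by (simp add: agree_off_def)
    ultimately show "\<exists>g\<in>?E (root w). agree_off k (snd (hd w)) g"
      by blast
  next
    assume "\<exists>g\<in>?E (root w). agree_off k (snd (hd w)) g"
    then obtain g where g: "g \<in> ?E (root w)" "agree_off k (snd (hd w)) g"
      by blast
    have "agree_off k (snd (hd u)) g"
      using u(3) g(2) by (simp add: agree_off_def)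
    moreover have "g \<in> V (root u)"
      using g(1) E_sub u(2) by auto
    \<comment> \<open>Extending \<open>u\<close> instead of \<open>w\<close> keeps consecutive
      directions distinct.\<close>
    ultimately have p: "path V ((k, g) # u)"
      using u u_ne by (auto simp: path_Cons)
    have "seq_of ((k, g) # u) \<in> ?T"
      using Cyl.IH[OF p] len Cyl.prems(2) g(1) u(2) u_ne by simp
    moreover have "strip k ((k, g) # u) = u"
      using path_strip[OF p] by simp
    ultimately show "\<exists>w'. path V w' \<and> seq_of w' \<in> ?T \<and> strip k w' = u"
      using p by blast
  qed
  also have "\<dots> \<longleftrightarrow> snd (hd w) \<in> eval (full_set_alg (V (root w))) (e (root w)) (Cyl k t)"
    using path_hd_in[OF Cyl.prems(1)] w_ne
    by (auto simp: cylindrification_def)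
  finally show ?case .
next
  case Unit
  then show ?case
    using path_hd_in[of V w] by (auto simp: tree_def)
next
  case (Compl t)
  then show ?case
    using path_hd_in[of V w] by (cases "w = []") (auto simp: tree_def)
qed auto

text \<open>Moves alternating between \<open>r\<close> and \<open>s\<close>, all with target
  \<open>f\<close>, lengthen the path without changing the point.\<close>

lemma deep_path:
  fixes r s :: 'i
  assumes "r \<noteq> s" "f \<in> V r"
  shows "\<exists>w. path V w \<and> length w = Suc n \<and> root w = r \<and> snd (hd w) = f"
proof -
  have "\<exists>w. path V w \<and> length w = Suc n \<and> root w = r \<and> snd (hd w) = f \<and> fst (hd w) \<in> {r, s}"
  proof (induction n)
    case 0
    show ?case
      by (rule exI[of _ "[(r, f)]"]) (use assms in auto)
  next
    case (Suc n)
    then obtain w where w: "path V w" "length w = Suc n" "root w = r" "snd (hd w) = f"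
      "fst (hd w) \<in> {r, s}"
      by blast
    obtain k where k: "k \<in> {r, s}" "k \<noteq> fst (hd w)"
      using assms(1) by blast
    have "w \<noteq> []"
      using w(2) by auto
    then show ?case
      using w k assms(2)
      by (intro exI[of _ "(k, f) # w"]) (simp add: path_Cons agree_off_refl)
  qed
  then show ?thesis
    by blast
qed

text \<open>A node and its parent differ only in the direction of the latest move, so a set closed
  under every cylindrification cannot separate them; iterating leads to the root.\<close>

lemma path_connected_root:
  assumes closed: "\<And>i. cylindrification (tree V) i Y = Y"
    and "path V w"
  shows "seq_of w \<in> Y \<longleftrightarrow> seq_of [] \<in> Y"
  using assms(2)
proof (induction w)
  case (Cons m w)
  have "strip (fst m) (m # w) = strip (fst m) w"
    by (simp add: strip_def)
  then have agree: "agree_off (fst m) (seq_of (m # w)) (seq_of w)"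
    "agree_off (fst m) (seq_of w) (seq_of (m # w))"
    by (simp_all add: agree_off_seq_of)
  have "seq_of (m # w) \<in> tree V" "seq_of w \<in> tree V"
    using Cons.prems path_tl[OF Cons.prems] by (auto simp: tree_def)
  then have "seq_of (m # w) \<in> Y \<longleftrightarrow> seq_of w \<in> Y"
    using closed[of "fst m"] agree by (auto simp: cylindrification_def)
  then show ?case
    using Cons.IH path_tl[OF Cons.prems] by simp
qed simp

subsection \<open>Zero-dimensional terms\<close>

lemma zero_dimensional_term:
  fixes t :: "('i, 'x) trm"
  assumes "\<exists>i j :: 'i. i \<noteq> j"
    and closed: "\<And>i. Drs_valid TYPE('u::infinite) (Cyl i t) t"
  shows "Drs_valid TYPE('u) t Zero \<or> Drs_valid TYPE('u) t Unit"
proof (rule ccontr)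
  assume neg: "\<not> (Drs_valid TYPE('u) t Zero \<or> Drs_valid TYPE('u) t Unit)"
  obtain V1 :: "('i \<Rightarrow> 'u) set" and e1 where
    e1: "\<forall>x. e1 x \<subseteq> V1" and ne1: "eval (full_set_alg V1) e1 t \<noteq> {}"
    using neg by (auto simp: Drs_valid_iff)
  then obtain f1 where f1: "f1 \<in> eval (full_set_alg V1) e1 t" "f1 \<in> V1"
    using eval_full_set_alg_subset[of e1 V1 t] by blast
  obtain V2 :: "('i \<Rightarrow> 'u) set" and e2 where
    e2: "\<forall>x. e2 x \<subseteq> V2" and ne2: "eval (full_set_alg V2) e2 t \<noteq> V2"
    using neg by (auto simp: Drs_valid_iff)
  then obtain f2 where f2: "f2 \<notin> eval (full_set_alg V2) e2 t" "f2 \<in> V2"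
    using eval_full_set_alg_subset[of e2 V2 t] by blast
  obtain i j :: 'i where ij: "i \<noteq> j"
    using assms(1) by blast
  \<comment> \<open>A first move in direction \<open>i\<close> leads into \<open>V1\<close>, one in
    direction \<open>j\<close> into \<open>V2\<close>; both kinds of path start from the same empty
    path.\<close>
  define V where "V k = (if k = i then V1 else V2)" for k
  define e where "e k = (if k = i then e1 else e2)" for k
  have e: "e k x \<subseteq> V k" for k x
    using e1 e2 by (simp add: e_def V_def)
  let ?Y = "eval (full_set_alg (tree V)) (tree_val V e) t"
  \<comment> \<open>The tree is built over lists of moves, not over \<open>'u\<close>, so validity
    has to change universe.\<close>
  have "satisfies (full_set_alg (tree V)) (Cyl k t) t" for k
  proof (rule Drs_valid_universal[OF closed])
    have "seq_of [] \<in> tree V"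
      by (auto simp: tree_def)
    then show "full_set_alg (tree V) \<in> Drs TYPE(('i \<times> ('i \<Rightarrow> 'u)) list)"
      by (intro full_set_alg_in_Drs) auto
  qed
  moreover have "range (tree_val V e) \<subseteq> carr (full_set_alg (tree V))"
    using tree_val_subset by fastforce
  ultimately have "eval (full_set_alg (tree V)) (tree_val V e) (Cyl k t) = ?Y" for k
    by (simp only: satisfies_def)
  then have cl: "cylindrification (tree V) k ?Y = ?Y" for k
    by simp
  obtain w1 where w1: "path V w1" "length w1 = Suc (depth t)" "root w1 = i" "snd (hd w1) = f1"
    using deep_path[OF ij, of f1 V "depth t"] f1(2) by (auto simp: V_def)
  obtain w2 where w2: "path V w2" "length w2 = Suc (depth t)" "root w2 = j" "snd (hd w2) = f2"
    using deep_path[OF ij[symmetric], of f2 V "depth t"] f2(2) ij by (auto simp: V_def)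
  \<comment> \<open>Both lengths exceed \<open>depth t\<close> by one, just enough for
    \<open>eval_tree\<close>.\<close>
  have "seq_of w1 \<in> ?Y" "seq_of w2 \<notin> ?Y"
    using eval_tree[OF w1(1), of t e] eval_tree[OF w2(1), of t e] w1 w2 e f1(1) f2(1) ij
    by (simp_all add: V_def e_def)
  then show False
    using path_connected_root[of V ?Y, OF cl] w1(1) w2(1) by blast
qed

theorem theorem3:
  fixes X :: "'x set"
  assumes "\<exists>i j :: 'i::wellorder. i \<noteq> j"
  shows "let F = (Fr_Drs TYPE('u::infinite) X :: ('i, ('i, 'x) trm set) cyl_alg)
         in {a \<in> carr F. zero_dimensional F a} = {zero F, unit F}"
proof -
  let ?F = "Fr_Drs TYPE('u) X :: ('i, ('i, 'x) trm set) cyl_alg"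
  let ?R = "Drs_cong TYPE('u) X :: (('i, 'x) trm \<times> ('i, 'x) trm) set"
  have F: "carr ?F = terms_over X // ?R" "zero ?F = ?R `` {Zero}" "unit ?F = ?R `` {Unit}"
    by (simp_all add: Fr_Drs_def Let_def)
  have zero_unit: "(Zero :: ('i, 'x) trm) \<in> terms_over X" "(Unit :: ('i, 'x) trm) \<in> terms_over X"
    by (auto simp: terms_over_def)
  \<comment> \<open>This turns questions about classes into validity of equations between
    terms.\<close>
  have class_eq: "?R `` {s} = ?R `` {t} \<longleftrightarrow> Drs_valid TYPE('u) s t"
    if "s \<in> terms_over X" "t \<in> terms_over X" for s t
    using eq_equiv_class_iff[OF equiv_Drs_cong that] that by (simp add: Drs_cong_def)
  have zero_dim: "zero_dimensional ?F (?R `` {t}) \<longleftrightarrow> (\<forall>i. Drs_valid TYPE('u) (Cyl i t) t)"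
    if t: "t \<in> terms_over X" for t
  proof -
    have "Cyl i t \<in> terms_over X" for i
      using t by (simp add: terms_over_def)
    then show ?thesis
      using t by (simp add: zero_dimensional_def dim_set_def Fr_Drs_ops class_eq)
  qed
  have "Drs_valid TYPE('u) (Cyl i Zero) (Zero :: ('i, 'x) trm)"
    "Drs_valid TYPE('u) (Cyl i Unit) (Unit :: ('i, 'x) trm)" for i
    using agree_off_refl by (fastforce simp: Drs_valid_iff cylindrification_def)+
  then have "zero_dimensional ?F (zero ?F)" "zero_dimensional ?F (unit ?F)"
    using zero_unit by (simp_all add: F zero_dim)
  moreover have "zero ?F \<in> carr ?F" "unit ?F \<in> carr ?F"
    using zero_unit by (simp_all add: F quotientI)
  moreover have "a \<in> {zero ?F, unit ?F}" if a: "a \<in> carr ?F" "zero_dimensional ?F a" for a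
  proof -
    obtain t where t: "t \<in> terms_over X" "a = ?R `` {t}"
      using a(1) by (auto simp: F elim: quotientE)
    then have "Drs_valid TYPE('u) t Zero \<or> Drs_valid TYPE('u) t Unit"
      using zero_dimensional_term[OF assms] a(2) zero_dim by blast
    then show ?thesis
      using t zero_unit by (auto simp: F class_eq)
  qed
  ultimately show ?thesis
    by (auto simp: Let_def)
qed

end
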